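(* Consider the APLC testing problem described in the context. If $r>\rho(\beta;\sigma)$, then the Berk–Jones statistic $M_n$ is asymptotically powerful (as a test rejecting $H_0$ for small values of $M_n$): there exist thresholds $h_n$ such that $$\Pr_{H_0}(M_n<h_n)+\Pr_{H_1^{(n)}}(M_n\ge h_n)\to 0\quad (n\to\infty).$$
   Context: For $\mu\in\mathbb R$ and $\sigma>0$, $\chi^2(\mu,\sigma)$ denotes the law of $(\mu+\sigma Z)^2$ with $Z\sim\mathcal N(0,1)$; $\chi^2_2$ denotes the chi-squared law with two degrees of freedom (density $\tfrac12 e^{-u/2}$ on $u>0$). APLC testing problem: for each $n$ one observes independent random variables $p_1,\dots,p_n\in(0,1)$. Under $H_0$, $p_1,\dots,p_n$ are i.i.d. $\mathrm{Unif}(0,1)$, i.e. $-2\log p_i\sim\chi^2_2$. Under $H_1^{(n)}$, the $p_i$ are independent with $-2\log p_i\sim(1-\epsilon_n)\chi^2_2+\epsilon_n Q_i^{(n)}$, $i=1,\dots,n$, where $\epsilon_n=n^{-\beta}$, $\mu_n=\sqrt{2r\log n}$, $\beta\in(0,1)$, $r>0$, $\sigma>0$ are fixed (independent of $n$), and each $Q_i^{(n)}$ is a probability distribution on $(0,\infty)$ with a density satisfying the APLC condition: for every $q>0$, $$\lim_{n\to\infty}\frac{1}{\log n}\max_{1\le i\le n}\left|\log\frac{dQ_i^{(n)}}{d\chi^2(\mu_n,\sigma)}(q\log n)\right|=0,$$ where $\frac{dQ_i^{(n)}}{d\chi^2(\mu_n,\sigma)}$ is the ratio of the densities. The function $\rho(\beta;\sigma)$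 is defined for $\beta\in(1/2,1)$ by: if $0<\sigma^2<2$, $\rho(\beta;\sigma)=(2-\sigma^2)(\beta-1/2)$ for $1/2<\beta<1-\sigma^2/4$ and $\rho(\beta;\sigma)=(1-\sigma\sqrt{1-\beta})^2$ for $1-\sigma^2/4\le\beta<1$; if $\sigma^2\ge 2$, $\rho(\beta;\sigma)=0$ for $1/2<\beta<1-1/\sigma^2$ and $\rho(\beta;\sigma)=(1-\sigma\sqrt{1-\beta})^2$ for $1-1/\sigma^2\le\beta<1$. Berk–Jones statistic: with $p_{(1)}\le\dots\le p_{(n)}$ the order statistics, let $\pi_i=\Pr(\mathrm{Beta}(i,n-i+1)<p_{(i)})$ (probability over an independent Beta variable, conditional on the data), and $M_n=\min\{M_n^-,M_n^+\}$ with $M_n^-=\min_i\pi_i$, $M_n^+=\min_i(1-\pi_i)$. *)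

theory Defs
  imports "HOL-Probability.Probability"
begin

definition chi2_2_density :: "real \<Rightarrow> real" where
  "chi2_2_density u = (if u > 0 then exp (- u / 2) / 2 else 0)"

text \<open>Density of chi2(mu,sigma), the law of (mu + sigma Z)^2 with Z standard normal.\<close>
definition chi2nc_density :: "real \<Rightarrow> real \<Rightarrow> real \<Rightarrow> real" where
  "chi2nc_density \<mu> \<sigma> u =
     (if u > 0 then (normal_density \<mu> \<sigma> (sqrt u) + normal_density \<mu> \<sigma> (- sqrt u)) / (2 * sqrt u)
      else 0)"

text \<open>The detection boundary rho(beta;sigma), for 1/2 < beta < 1.\<close>
definition rho :: "real \<Rightarrow> real \<Rightarrow> real" where
  "rho \<beta> \<sigma> =
     (if \<sigma>\<^sup>2 < 2 then
        (if \<beta> < 1 - \<sigma>\<^sup>2 / 4 then (2 - \<sigma>\<^sup>2) * (\<beta> - 1/2)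
         else (1 - \<sigma> * sqrt (1 - \<beta>))\<^sup>2)
      else
        (if \<beta> < 1 - 1 / \<sigma>\<^sup>2 then 0
         else (1 - \<sigma> * sqrt (1 - \<beta>))\<^sup>2))"

definition beta_cdf :: "nat \<Rightarrow> nat \<Rightarrow> real \<Rightarrow> real" where
  "beta_cdf a b x =
     (LBINT t=0..x. t ^ (a - 1) * (1 - t) ^ (b - 1)) /
     (LBINT t=0..1. t ^ (a - 1) * (1 - t) ^ (b - 1))"

definition order_stat :: "nat \<Rightarrow> (nat \<Rightarrow> real) \<Rightarrow> nat \<Rightarrow> real" where
  "order_stat n p i = sort (map p [1..<n+1]) ! (i - 1)"

definition bj_pi :: "nat \<Rightarrow> (nat \<Rightarrow> real) \<Rightarrow> nat \<Rightarrow> real" where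
  "bj_pi n p i = beta_cdf i (n - i + 1) (order_stat n p i)"

definition berk_jones :: "nat \<Rightarrow> (nat \<Rightarrow> real) \<Rightarrow> real" where
  "berk_jones n p = min (Min ((\<lambda>i. bj_pi n p i) ` {1..n})) (Min ((\<lambda>i. 1 - bj_pi n p i) ` {1..n}))"

definition null_law :: "nat \<Rightarrow> (nat \<Rightarrow> real) measure" where
  "null_law n = PiM {1..n} (\<lambda>i. uniform_measure lborel {0<..<1})"

text \<open>Alternative law: independent p_i = exp(-U_i/2), U_i with density
  (1-eps) chi2_2 + eps q_i, i.e. -2 log p_i has that mixture law.\<close>
definition alt_law :: "real \<Rightarrow> (nat \<Rightarrow> real \<Rightarrow> real) \<Rightarrow> nat \<Rightarrow> (nat \<Rightarrow> real) measure" where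
  "alt_law \<epsilon> q n = PiM {1..n} (\<lambda>i.
      distr (density lborel (\<lambda>u. ennreal ((1 - \<epsilon>) * chi2_2_density u + \<epsilon> * q i u))) borel
            (\<lambda>u. exp (- u / 2)))"

end

theory Submission
  imports Defs "HOL-Real_Asymp.Real_Asymp"
begin

text \<open>
  The Beta distribution function is a binomial tail, so each \<open>\<pi>\<^sub>i\<close> is uniform under the null
  hypothesis and a union bound gives \<open>P(M\<^sub>n < h) \<le> 2 n h\<close>; the threshold \<open>h\<^sub>n = n\<^sup>-\<^sup>2\<close> is small
  enough. Under the alternative, only the index \<open>i = N\<close>, the number of p-values below \<open>n\<^sup>-\<^sup>s\<close>, is
  needed. Condition \<open>r > \<rho>\<close> provides a level \<open>s\<close> at which the expected excess of \<open>N\<close> over its null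
  mean \<open>n\<^sup>1\<^sup>-\<^sup>s\<close> exceeds the null standard deviation by a power of \<open>n\<close>. Chernoff bounds then show both
  that half of this excess is realised with probability tending to one and that the binomial tail
  at \<open>N\<close> is smaller than any power of \<open>n\<close>.
\<close>

section \<open>Order statistics and counts of small p-values\<close>

text \<open>In a sorted list the entries at most \<open>x\<close> form an initial segment.\<close>

lemma sorted_nth_le_iff:
  fixes x :: "'a::linorder"
  assumes "sorted xs" "k < length xs"
  shows "xs ! k \<le> x \<longleftrightarrow> k < length (filter (\<lambda>y. y \<le> x) xs)"
  using assms
proof (induction xs arbitrary: k)
  case (Cons y ys)
  show ?case
  proof (cases "y \<le> x")
    case True
    then show ?thesis using Cons by (cases k) auto
  next
    case False
    then have all: "\<forall>z\<in>set (y # ys). \<not> z \<le> x" using Cons.prems(1) by auto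
    moreover have "(y # ys) ! k \<in> set (y # ys)" using Cons.prems(2) nth_mem by blast
    ultimately have "\<not> (y # ys) ! k \<le> x" by blast
    moreover have "filter (\<lambda>z. z \<le> x) (y # ys) = []" using all by (simp add: filter_empty_conv)
    ultimately show ?thesis by simp
  qed
qed simp

text \<open>Order statistics are dependent, whereas counts are sums of independent indicators; this
  bridge lets all probability estimates run on counts.\<close>

lemma order_stat_le_iff:
  assumes "i \<in> {1..n}"
  shows "order_stat n p i \<le> x \<longleftrightarrow> i \<le> card {j\<in>{1..n}. p j \<le> x}"
proof -
  let ?xs = "map p [1..<n+1]"
  have "length (filter (\<lambda>y. y \<le> x) (sort ?xs)) = length (filter (\<lambda>y. y \<le> x) ?xs)"
    by (metis mset_filter mset_sort size_mset)
  also have "\<dots> = length (filter (\<lambda>j. p j \<le> x) [1..<n+1])"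
    by (simp add: filter_map o_def)
  also have "\<dots> = card {j\<in>{1..n}. p j \<le> x}"
    by (simp add: distinct_length_filter) (rule arg_cong[where f=card], auto)
  finally have len: "length (filter (\<lambda>y. y \<le> x) (sort ?xs)) = card {j\<in>{1..n}. p j \<le> x}" .
  have "i - 1 < length (sort ?xs)" using assms by (simp only: length_sort) auto
  then have "sort ?xs ! (i - 1) \<le> x \<longleftrightarrow> i - 1 < card {j\<in>{1..n}. p j \<le> x}"
    using sorted_nth_le_iff[of "sort ?xs" "i - 1" x] unfolding len by simp
  then show ?thesis using assms unfolding order_stat_def by auto
qed

section \<open>Binomial upper tails and the Beta distribution function\<close>

text \<open>For \<open>x\<close> in the unit interval this is the probability that a binomial
  variable with parameters \<open>n\<close> and \<open>x\<close> is at least \<open>i\<close>; as a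
  polynomial it makes sense for every real \<open>x\<close>.\<close>

definition bin_tail :: "nat \<Rightarrow> nat \<Rightarrow> real \<Rightarrow> real" where
  "bin_tail n i x = (\<Sum>k=i..n. real (n choose k) * x ^ k * (1 - x) ^ (n - k))"

lemma bin_tail_at_0: "1 \<le> i \<Longrightarrow> bin_tail n i 0 = 0"
  by (simp add: bin_tail_def)

lemma bin_tail_at_1: "i \<le> n \<Longrightarrow> bin_tail n i 1 = 1"
proof -
  assume "i \<le> n"
  have "bin_tail n i 1 = (\<Sum>k=i..n. if k = n then 1 else 0)"
    unfolding bin_tail_def by (intro sum.cong refl) (auto simp: power_0_left)
  then show ?thesis using \<open>i \<le> n\<close> by simp
qed

text \<open>Each summand has a derivative made of two monomials, and the negative one cancels
  against the next summand, so only the lower boundary term survives. The telescoping is run as a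
  downward induction from \<open>i = n\<close>.\<close>

lemma bin_tail_deriv:
  assumes "1 \<le> i" "i \<le> n"
  shows "(bin_tail n i has_real_derivative
    real n * real ((n - 1) choose (i - 1)) * (x ^ (i - 1) * (1 - x) ^ (n - i))) (at x)"
  using assms(2,1)
proof (induction i rule: inc_induct)
  case base
  have "bin_tail n n = (\<lambda>x. x ^ n)" by (auto simp: bin_tail_def)
  then show ?case using base by (auto intro!: derivative_eq_intros)
next
  case (step i)
  have eq: "bin_tail n i = (\<lambda>x. real (n choose i) * x ^ i * (1 - x) ^ (n - i) + bin_tail n (Suc i) x)"
    using step.hyps by (auto simp: bin_tail_def sum.atLeast_Suc_atMost)
  \<comment> \<open>The absorption identities give both monomials the prefactor \<open>n\<close>; by
    \<open>2\<close> the negative one is exactly opposite to the derivative of the tail from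
    \<open>Suc i\<close>.\<close>
  have 1: "real i * real (n choose i) = real n * real ((n - 1) choose (i - 1))"
    using step times_binomial_minus1_eq[of i n] by (metis of_nat_mult less_eq_Suc_le One_nat_def)
  have 2: "real (n - i) * real (n choose i) = real n * real ((n - 1) choose i)"
    using step by (metis binomial_absorb_comp of_nat_mult)
  have IH: "(bin_tail n (Suc i) has_real_derivative
      real n * real ((n - 1) choose i) * (x ^ i * (1 - x) ^ (n - Suc i))) (at x)"
    using step.IH by simp
  have "(bin_tail n i has_real_derivative
      (real i * real (n choose i)) * (x ^ (i - 1) * (1 - x) ^ (n - i))
      - (real (n - i) * real (n choose i)) * (x ^ i * (1 - x) ^ (n - Suc i))
      + real n * real ((n - 1) choose i) * (x ^ i * (1 - x) ^ (n - Suc i))) (at x)"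
    unfolding eq by (auto intro!: derivative_eq_intros IH simp: algebra_simps)
  then show ?case unfolding 1 2 by simp
qed

lemma bin_tail_mono:
  assumes "1 \<le> i" "i \<le> n" "0 \<le> x" "x \<le> y" "y \<le> 1"
  shows "bin_tail n i x \<le> bin_tail n i y"
  using assms(4)
proof (rule DERIV_nonneg_imp_nondecreasing)
  fix z assume "x \<le> z" "z \<le> y"
  then show "\<exists>D. DERIV (bin_tail n i) z :> D \<and> D \<ge> 0"
    using assms by (intro exI[of _ "real n * real ((n - 1) choose (i - 1)) * (z ^ (i - 1) * (1 - z) ^ (n - i))"]
        conjI bin_tail_deriv) auto
qed

lemma bin_tail_isCont: "isCont (bin_tail n i) x"
  unfolding bin_tail_def by (intro continuous_intros)

text \<open>The tail moves continuously from 0 to 1, so it has quantiles. They later turn a bound on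
  \<open>bj_pi\<close> into an event about counts.\<close>

lemma bin_tail_attains:
  assumes "1 \<le> i" "i \<le> n" "0 \<le> h" "h \<le> 1"
  obtains x where "0 \<le> x" "x \<le> 1" "bin_tail n i x = h"
  using IVT[of "bin_tail n i" 0 h 1] assms bin_tail_isCont
  by (auto simp: bin_tail_at_0 bin_tail_at_1)

text \<open>The tail divided by \<open>?c\<close> is an antiderivative of the unnormalised Beta
  density, and \<open>?c\<close> cancels in the quotient of the two integrals.\<close>

lemma beta_cdf_eq_bin_tail:
  assumes "1 \<le> i" "i \<le> n"
  shows "beta_cdf i (n - i + 1) x = bin_tail n i x"
proof -
  let ?c = "real n * real ((n - 1) choose (i - 1))"
  have c: "?c \<noteq> 0" using assms by auto
  \<comment> \<open>Here \<open>y\<close> is any real; the interval from \<open>min 0 y\<close> to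
    \<open>max 0 y\<close> covers both orientations of the integral.\<close>
  have int: "(LBINT t=0..y. t ^ (i - 1) * (1 - t) ^ (n - i + 1 - 1)) = bin_tail n i y / ?c" for y :: real
  proof -
    have "((\<lambda>x. bin_tail n i x / ?c) has_vector_derivative t ^ (i - 1) * (1 - t) ^ (n - i))
        (at t within {min 0 y..max 0 y})" for t
    proof -
      have "((\<lambda>x. bin_tail n i x / ?c) has_real_derivative
          (?c * (t ^ (i - 1) * (1 - t) ^ (n - i))) / ?c) (at t)"
        by (rule DERIV_cdivide[OF bin_tail_deriv[OF assms]])
      then show ?thesis
        unfolding nonzero_mult_div_cancel_left[OF c] has_real_derivative_iff_has_vector_derivative
        by (rule has_vector_derivative_at_within)
    qed
    then have "(LBINT t=ereal 0..ereal y. t ^ (i - 1) * (1 - t) ^ (n - i))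
        = bin_tail n i y / ?c - bin_tail n i 0 / ?c"
      by (intro interval_integral_FTC_finite) (auto intro!: continuous_intros)
    then show ?thesis using assms by (simp add: zero_ereal_def bin_tail_at_0)
  qed
  show ?thesis
    using int[of x] int[of 1] c assms by (simp add: beta_cdf_def bin_tail_at_1 one_ereal_def)
qed

text \<open>Exponential Markov inequality on the level of sums: the weight
  \<open>exp (\<theta> * (k - i))\<close> is at least 1 for \<open>k \<ge> i\<close>, the weighted
  sum extends to all \<open>k\<close>, and the binomial theorem evaluates it. The last step is
  \<open>1 + y \<le> exp y\<close>.\<close>

lemma bin_tail_chernoff:
  assumes "0 \<le> x" "x \<le> 1" "0 \<le> \<theta>"
  shows "bin_tail n i x \<le> exp (real n * x * (exp \<theta> - 1) - \<theta> * real i)"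
proof -
  have "bin_tail n i x \<le> (\<Sum>k=i..n. exp (- \<theta> * real i) * (real (n choose k) * (x * exp \<theta>) ^ k * (1 - x) ^ (n - k)))"
    unfolding bin_tail_def
  proof (rule sum_mono)
    fix k assume k: "k \<in> {i..n}"
    then have "1 \<le> exp (\<theta> * real k - \<theta> * real i)"
      using assms by (simp add: mult_left_mono)
    then have "real (n choose k) * x ^ k * (1 - x) ^ (n - k) * 1
       \<le> real (n choose k) * x ^ k * (1 - x) ^ (n - k) * exp (\<theta> * real k - \<theta> * real i)"
      by (rule mult_left_mono) (use assms in auto)
    then show "real (n choose k) * x ^ k * (1 - x) ^ (n - k)
      \<le> exp (- \<theta> * real i) * (real (n choose k) * (x * exp \<theta>) ^ k * (1 - x) ^ (n - k))"
      by (simp add: power_mult_distrib exp_diff exp_minus field_simps flip: exp_of_nat_mult)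
  qed
  also have "\<dots> \<le> (\<Sum>k=0..n. exp (- \<theta> * real i) * (real (n choose k) * (x * exp \<theta>) ^ k * (1 - x) ^ (n - k)))"
    by (rule sum_mono2) (use assms in auto)
  also have "\<dots> = exp (- \<theta> * real i) * (x * exp \<theta> + (1 - x)) ^ n"
    by (subst binomial_ring) (simp add: sum_distrib_left atMost_atLeast0)
  also have "\<dots> \<le> exp (- \<theta> * real i) * exp (x * (exp \<theta> - 1)) ^ n"
  proof (intro mult_left_mono power_mono)
    show "x * exp \<theta> + (1 - x) \<le> exp (x * (exp \<theta> - 1))"
      using exp_ge_add_one_self[of "x * (exp \<theta> - 1)"] by (simp add: algebra_simps)
  qed (use assms in auto)
  also have "\<dots> = exp (real n * x * (exp \<theta> - 1) - \<theta> * real i)"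
    by (simp add: exp_add[symmetric] exp_of_nat_mult[symmetric] algebra_simps)
  finally show ?thesis .
qed

section \<open>Counts under product laws and the error under the null hypothesis\<close>

text \<open>Splitting by the exact set \<open>S\<close> of coordinates at most \<open>x\<close>
  yields finitely many boxes, which give measurability and, under the null, the probability.\<close>

lemma count_event_eq:
  fixes x :: real
  assumes "finite I"
  shows "{p \<in> PiE I (\<lambda>_. UNIV). i \<le> card {j\<in>I. p j \<le> x}} =
    (\<Union>S\<in>{S. S \<subseteq> I \<and> i \<le> card S}. PiE I (\<lambda>j. if j \<in> S then {..x} else {x<..}))"
    (is "?A = ?B")
proof
  show "?A \<subseteq> ?B"
  proof
    fix p assume p: "p \<in> ?A"
    have "p \<in> PiE I (\<lambda>j. if j \<in> {j\<in>I. p j \<le> x} then {..x} else {x<..})"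
    proof (rule PiE_I)
      show "p j = undefined" if "j \<notin> I" for j using p that by (auto dest: PiE_arb)
    qed auto
    moreover have "{j\<in>I. p j \<le> x} \<in> {S. S \<subseteq> I \<and> i \<le> card S}" using p by auto
    ultimately show "p \<in> ?B" by (intro UN_I)
  qed
  show "?B \<subseteq> ?A"
  proof
    fix p assume "p \<in> ?B"
    then obtain S where S: "S \<subseteq> I" "i \<le> card S"
      and p: "p \<in> PiE I (\<lambda>j. if j \<in> S then {..x} else {x<..})" by blast
    have "p j \<le> x" if "j \<in> S" for j
      using PiE_mem[OF p, of j] that S by auto
    then have "card S \<le> card {j\<in>I. p j \<le> x}"
      using S assms by (intro card_mono) auto
    with S p show "p \<in> ?A" by (auto simp: PiE_def)
  qed
qed

lemma count_event_sets:
  fixes x :: real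
  assumes "finite I" "\<And>j. j \<in> I \<Longrightarrow> sets (M j) = sets borel"
  shows "{p \<in> space (PiM I M). i \<le> card {j\<in>I. p j \<le> x}} \<in> sets (PiM I M)"
proof -
  have "space (PiM I M) = PiE I (\<lambda>_. UNIV)"
    using sets_eq_imp_space_eq[OF assms(2)] by (auto simp: space_PiM cong: PiE_cong)
  then show ?thesis
    using assms by (auto simp: count_event_eq intro!: sets.finite_UN sets_PiM_I_finite)
qed

lemma prob_space_unif: "prob_space (uniform_measure lborel {0<..<1::real})"
  by (rule prob_space_uniform_measure) auto

lemma finite_product_prob_space_unif:
  "finite I \<Longrightarrow> finite_product_prob_space (\<lambda>_. uniform_measure lborel {0<..<1::real}) I"
  unfolding finite_product_prob_space_def product_prob_space_def product_sigma_finite_def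
    product_prob_space_axioms_def finite_product_sigma_finite_def
    finite_product_sigma_finite_axioms_def
  using prob_space_unif prob_space_imp_sigma_finite by blast

lemma measure_unif:
  assumes "0 \<le> x" "x \<le> 1"
  shows "measure (uniform_measure lborel {0<..<1::real}) {..x} = x"
    and "measure (uniform_measure lborel {0<..<1::real}) {x<..} = 1 - x"
proof -
  have "measure (uniform_measure lborel {0<..<1::real}) {..x} = measure lborel {0<..<1::real} * x"
  proof -
    have "{0<..<1} \<inter> {..x} = (if x = 1 then {0<..<1} else {0<..x})" using assms by auto
    then show ?thesis using assms by simp
  qed
  then show 1: "measure (uniform_measure lborel {0<..<1::real}) {..x} = x" by simp
  have "{x<..} = space (uniform_measure lborel {0<..<1::real}) - {..x}" by auto
  then show "measure (uniform_measure lborel {0<..<1::real}) {x<..} = 1 - x"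
    using prob_space.prob_compl[OF prob_space_unif, of "{..x}"] 1 by simp
qed

text \<open>Independence gives the box of \<open>S\<close> the probability
  \<open>x ^ card S * (1 - x) ^ (n - card S)\<close>; adding up the boxes by cardinality produces
  the binomial coefficients.\<close>

lemma null_count_prob:
  assumes "0 \<le> x" "x \<le> 1"
  shows "measure (null_law n) {p \<in> space (null_law n). i \<le> card {j\<in>{1..n}. p j \<le> x}} = bin_tail n i x"
proof -
  let ?U = "uniform_measure lborel {0<..<1::real}"
  interpret finite_product_prob_space "\<lambda>_. ?U" "{1..n}"
    by (rule finite_product_prob_space_unif) simp
  let ?F = "{S. S \<subseteq> {1..n} \<and> i \<le> card S}"
  let ?E = "\<lambda>S. PiE {1..n} (\<lambda>j. if j \<in> S then {..x} else {x<..})"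
  have fin: "finite ?F" by simp
  have "{p \<in> space (null_law n). i \<le> card {j\<in>{1..n}. p j \<le> x}} = (\<Union>S\<in>?F. ?E S)"
    unfolding null_law_def space_PiM by (subst count_event_eq[symmetric]) (auto simp: space_PiM)
  then have "measure (null_law n) {p \<in> space (null_law n). i \<le> card {j\<in>{1..n}. p j \<le> x}}
      = prob (\<Union>S\<in>?F. ?E S)" by (simp add: null_law_def)
  also have "\<dots> = (\<Sum>S\<in>?F. prob (?E S))"
  proof (rule finite_measure_finite_Union[OF fin])
    show "?E ` ?F \<subseteq> events" by (auto intro!: sets_PiM_I_finite)
    show "disjoint_family_on ?E ?F"
      \<comment> \<open>A coordinate lying in exactly one of \<open>S\<close> and \<open>T\<close>
        would have to be both at most \<open>x\<close> and above \<open>x\<close>.\<close>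
      unfolding disjoint_family_on_def
    proof (intro ballI impI, rule ccontr)
      fix S T assume ST: "S \<in> ?F" "T \<in> ?F" "S \<noteq> T" "?E S \<inter> ?E T \<noteq> {}"
      then obtain p where p: "p \<in> ?E S" "p \<in> ?E T" by blast
      from ST obtain j where j: "j \<in> {1..n}" "(j \<in> S) \<noteq> (j \<in> T)" by blast
      then show False using PiE_mem[OF p(1) j(1)] PiE_mem[OF p(2) j(1)] by (auto split: if_splits)
    qed
  qed
  also have "\<dots> = (\<Sum>S\<in>?F. x ^ card S * (1 - x) ^ (n - card S))"
  proof (rule sum.cong[OF refl])
    fix S assume S: "S \<in> ?F"
    have "prob (?E S) = (\<Prod>j\<in>{1..n}. measure ?U (if j \<in> S then {..x} else {x<..}))"
      by (rule prob_times) auto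
    also have "\<dots> = (\<Prod>j\<in>{1..n}. if j \<in> S then x else 1 - x)"
      using measure_unif[OF assms] by (intro prod.cong refl) (simp del: measure_uniform_measure)
    also have "\<dots> = x ^ card ({1..n} \<inter> S) * (1 - x) ^ card ({1..n} \<inter> - S)"
      by (simp add: prod.If_cases)
    also have "{1..n} \<inter> S = S" using S by auto
    also have "{1..n} \<inter> - S = {1..n} - S" by auto
    also have "card ({1..n} - S) = n - card S"
      using S by (subst card_Diff_subset) (auto intro: finite_subset)
    finally show "prob (?E S) = x ^ card S * (1 - x) ^ (n - card S)" .
  qed
  also have "\<dots> = (\<Sum>k=i..n. \<Sum>S\<in>{S\<in>?F. card S = k}. x ^ card S * (1 - x) ^ (n - card S))"
    by (rule sum.group[symmetric]) (auto dest: card_mono[rotated])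
  also have "\<dots> = bin_tail n i x"
    unfolding bin_tail_def
  proof (rule sum.cong[OF refl])
    fix k assume k: "k \<in> {i..n}"
    then have "{S\<in>?F. card S = k} = {S. S \<subseteq> {1..n} \<and> card S = k}" by auto
    then show "(\<Sum>S\<in>{S\<in>?F. card S = k}. x ^ card S * (1 - x) ^ (n - card S))
        = real (n choose k) * x ^ k * (1 - x) ^ (n - k)"
      using n_subsets[of "{1..n}" k] by simp
  qed
  finally show ?thesis .
qed

lemma null_law_AE: "AE p in null_law n. \<forall>j\<in>{1..n}. p j \<in> {0<..<1}"
  unfolding null_law_def
proof (intro AE_finite_allI AE_PiM_component prob_space_unif)
  show "AE x in uniform_measure lborel {0<..<1::real}. x \<in> {0<..<1}"
    by (rule AE_uniform_measureI) auto
qed auto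

lemma order_stat_mem: "i \<in> {1..n} \<Longrightarrow> order_stat n p i \<in> p ` {1..n}"
proof -
  assume i: "i \<in> {1..n}"
  let ?xs = "map p [1..<n+1]"
  have "sort ?xs ! (i - 1) \<in> set (sort ?xs)" using i by (intro nth_mem) (simp only: length_sort, auto)
  also have "set (sort ?xs) = p ` {1..n}" by (simp only: set_sort set_map set_upt) auto
  finally show ?thesis by (simp add: order_stat_def)
qed

lemma bj_pi_eq: "i \<in> {1..n} \<Longrightarrow> bj_pi n p i = bin_tail n i (order_stat n p i)"
  unfolding bj_pi_def by (intro beta_cdf_eq_bin_tail) auto

text \<open>Each of the \<open>2 * n\<close> competing values in the minimum falls below
  \<open>h\<close> only on an event about one count, namely at the \<open>h\<close>-quantile
  \<open>x i\<close> or the \<open>1 - h\<close>-quantile \<open>y i\<close> of the tail. Each such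
  event has probability exactly \<open>h\<close>.\<close>

lemma berk_jones_null_bound:
  assumes "0 \<le> h" "h \<le> 1" "1 \<le> n"
  shows "measure (null_law n) {p \<in> space (null_law n). berk_jones n p < h} \<le> 2 * real n * h"
proof -
  let ?M = "null_law n" and ?N = "\<lambda>x p. card {j\<in>{1..n}. p j \<le> x}"
  interpret prob_space ?M unfolding null_law_def by (intro prob_space_PiM prob_space_unif)
  have "\<exists>x. i \<in> {1..n} \<longrightarrow> 0 \<le> x \<and> x \<le> 1 \<and> bin_tail n i x = h" for i
    using bin_tail_attains[of i n h] assms by (metis atLeastAtMost_iff)
  then obtain x where x: "\<And>i. i \<in> {1..n} \<Longrightarrow> 0 \<le> x i \<and> x i \<le> 1 \<and> bin_tail n i (x i) = h" by metis
  have "\<exists>y. i \<in> {1..n} \<longrightarrow> 0 \<le> y \<and> y \<le> 1 \<and> bin_tail n i y = 1 - h" for i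
    using bin_tail_attains[of i n "1 - h"] assms by (metis atLeastAtMost_iff diff_ge_0_iff_ge diff_le_eq add_increasing2 order_refl)
  then obtain y where y: "\<And>i. i \<in> {1..n} \<Longrightarrow> 0 \<le> y i \<and> y i \<le> 1 \<and> bin_tail n i (y i) = 1 - h" by metis
  let ?A = "\<lambda>i. {p \<in> space ?M. i \<le> ?N (x i) p}" and ?C = "\<lambda>i. {p \<in> space ?M. i \<le> ?N (y i) p}"
  have meas: "{p \<in> space ?M. i \<le> ?N z p} \<in> events" for i z
    unfolding null_law_def by (rule count_event_sets) auto
  have "prob {p \<in> space ?M. berk_jones n p < h} \<le> prob (\<Union>i\<in>{1..n}. ?A i \<union> (space ?M - ?C i))"
  proof (rule finite_measure_mono_AE)
    \<comment> \<open>The inclusion is almost sure: \<open>bin_tail_mono\<close> compares points of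
      the unit interval, where the order statistics lie outside a null set.\<close>
    show "AE p in ?M. p \<in> {p \<in> space ?M. berk_jones n p < h} \<longrightarrow>
        p \<in> (\<Union>i\<in>{1..n}. ?A i \<union> (space ?M - ?C i))"
      using null_law_AE AE_space
    proof eventually_elim
      case (elim p)
      show ?case
      proof
        assume "p \<in> {p \<in> space ?M. berk_jones n p < h}"
        then have "\<exists>i\<in>{1..n}. bj_pi n p i < h \<or> 1 - bj_pi n p i < h"
          using assms by (auto simp: berk_jones_def min_less_iff_disj Min_less_iff)
        then obtain i where i: "i \<in> {1..n}" and lt: "bj_pi n p i < h \<or> 1 - bj_pi n p i < h" by blast
        define z where "z = order_stat n p i"
        have z: "0 < z" "z < 1" using order_stat_mem[OF i, of p] elim(1) by (auto simp: z_def)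
        from lt have "p \<in> ?A i \<union> (space ?M - ?C i)"
        proof
          assume "bj_pi n p i < h"
          then have "bin_tail n i z < bin_tail n i (x i)" using x[OF i] bj_pi_eq[OF i] by (simp add: z_def)
          then have "\<not> x i \<le> z" using bin_tail_mono[of i n "x i" z] x[OF i] i z by auto
          then show ?thesis using order_stat_le_iff[OF i, of p "x i"] elim(2) by (simp add: z_def)
        next
          assume "1 - bj_pi n p i < h"
          then have "bin_tail n i (y i) < bin_tail n i z" using y[OF i] bj_pi_eq[OF i] by (simp add: z_def)
          then have "\<not> z \<le> y i" using bin_tail_mono[of i n z "y i"] y[OF i] i z by auto
          then show ?thesis using order_stat_le_iff[OF i, of p "y i"] elim(2) by (simp add: z_def)
        qed
        with i show "p \<in> (\<Union>i\<in>{1..n}. ?A i \<union> (space ?M - ?C i))" by blast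
      qed
    qed
    show "(\<Union>i\<in>{1..n}. ?A i \<union> (space ?M - ?C i)) \<in> events"
      by (intro sets.finite_UN sets.Un sets.Diff meas) auto
  qed
  also have "\<dots> \<le> (\<Sum>i\<in>{1..n}. prob (?A i \<union> (space ?M - ?C i)))"
    by (intro finite_measure_subadditive_finite image_subsetI sets.Un sets.Diff sets.top meas) simp
  also have "\<dots> \<le> (\<Sum>i\<in>{1..n}. 2 * h)"
  proof (rule sum_mono)
    fix i assume i: "i \<in> {1..n}"
    have "prob (?A i \<union> (space ?M - ?C i)) \<le> prob (?A i) + prob (space ?M - ?C i)"
      by (intro measure_Un_le sets.Diff meas) auto
    also have "prob (?A i) = h" using null_count_prob x[OF i] by simp
    also have "prob (space ?M - ?C i) = h"
      using prob_compl[OF meas, of i "y i"] null_count_prob y[OF i] by simp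
    finally show "prob (?A i \<union> (space ?M - ?C i)) \<le> 2 * h" by simp
  qed
  finally show ?thesis by simp
qed

section \<open>Chernoff bound for the lower tail of a count\<close>

text \<open>Markov's inequality for \<open>exp (\<theta> * (m - count))\<close>: independence
  factorises the expectation, and a coordinate with success probability at least \<open>f\<close>
  contributes at most \<open>1 - (1 - exp (- \<theta>)) * f\<close>, which is bounded by an
  exponential.\<close>

lemma count_lower_tail_chernoff:
  fixes M :: "nat \<Rightarrow> real measure"
  assumes fin: "finite I" and M: "\<And>j. j \<in> I \<Longrightarrow> prob_space (M j)"
    and sets: "\<And>j. j \<in> I \<Longrightarrow> sets (M j) = sets borel"
    and F: "\<And>j. j \<in> I \<Longrightarrow> f \<le> measure (M j) {..x}" and \<theta>: "0 \<le> \<theta>"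
  shows "measure (PiM I M) {p \<in> space (PiM I M). real (card {j\<in>I. p j \<le> x}) < m}
    \<le> exp (\<theta> * m - (1 - exp (- \<theta>)) * real (card I) * f)"
proof -
  \<comment> \<open>The product integral formula wants a sigma-finite measure at every index, so a
    point mass fills the indices outside \<open>I\<close>; the product over \<open>I\<close> is
    unchanged.\<close>
  define M' where "M' j = (if j \<in> I then M j else return borel 0)" for j
  have M'_prob: "prob_space (M' j)" for j using M by (auto simp: M'_def prob_space_return)
  have M'_sets [measurable_cong]: "sets (M' j) = sets borel" for j using sets by (auto simp: M'_def)
  have PiM: "PiM I M = PiM I M'" by (rule PiM_cong) (auto simp: M'_def)
  interpret product_sigma_finite M'
    by standard (use M'_prob prob_space_imp_sigma_finite in \<open>blast intro: sigma_finite_measure.sigma_finite_countable\<close>)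
  interpret prob_space "PiM I M'" by (intro prob_space_PiM M'_prob)
  define g where "g y = (if y \<le> x then exp (- \<theta>) else 1)" for y :: real
  have g_meas [measurable]: "g \<in> borel_measurable borel" unfolding g_def by measurable
  let ?A = "{p \<in> space (PiM I M'). real (card {j\<in>I. p j \<le> x}) < m}"
  \<comment> \<open>Decomposition by the exact value \<open>k\<close> of the count, each piece being
    a difference of two events from \<open>count_event_sets\<close>.\<close>
  have "?A = (\<Union>k\<in>{k. real k < m}. {p \<in> space (PiM I M'). k \<le> card {j\<in>I. p j \<le> x}}
      - {p \<in> space (PiM I M'). Suc k \<le> card {j\<in>I. p j \<le> x}})"
    by (auto simp: not_less_eq_eq dest: le_antisym)
  also have "\<dots> \<in> events"
    by (intro sets.countable_UN' sets.Diff count_event_sets fin M'_sets) auto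
  finally have A: "?A \<in> events" .
  have prod: "(\<Prod>j\<in>I. ennreal (g (p j))) = ennreal (exp (- \<theta> * real (card {j\<in>I. p j \<le> x})))" for p
  proof -
    have "(\<Prod>j\<in>I. g (p j)) = exp (- \<theta>) ^ card {j\<in>I. p j \<le> x}"
      using fin by (simp add: g_def prod.If_cases Int_def)
    then show ?thesis
      by (simp add: prod_ennreal g_def exp_of_nat_mult[symmetric] mult.commute)
  qed
  have int: "(\<integral>\<^sup>+ y. ennreal (g y) \<partial>M' j) \<le> ennreal (exp (- (1 - exp (- \<theta>)) * f))" if j: "j \<in> I" for j
  proof -
    interpret Mj: prob_space "M' j" by (rule M'_prob)
    have sp: "space (M' j) = UNIV" using sets_eq_imp_space_eq[OF M'_sets] by simp
    have c: "{x<..} = space (M' j) - {..x}" by (auto simp: sp)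
    have "(\<integral>\<^sup>+ y. ennreal (g y) \<partial>M' j)
        = (\<integral>\<^sup>+ y. ennreal (exp (- \<theta>)) * indicator {..x} y + indicator {x<..} y \<partial>M' j)"
      by (intro nn_integral_cong) (auto simp: g_def split: split_indicator)
    also have "\<dots> = ennreal (exp (- \<theta>)) * emeasure (M' j) {..x} + emeasure (M' j) {x<..}"
      by (subst nn_integral_add) (auto simp: nn_integral_cmult_indicator)
    also have "\<dots> = ennreal (exp (- \<theta>) * measure (M' j) {..x} + (1 - measure (M' j) {..x}))"
      unfolding c by (subst (1 2) Mj.emeasure_eq_measure, subst Mj.prob_compl)
        (auto simp: ennreal_mult'' ennreal_plus)
    also have "\<dots> \<le> ennreal (exp (- (1 - exp (- \<theta>)) * f))"
    proof (rule ennreal_leI)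
      have "(1 - exp (- \<theta>)) * f \<le> (1 - exp (- \<theta>)) * measure (M' j) {..x}"
        using F[OF j] j \<theta> by (intro mult_left_mono) (auto simp: M'_def)
      then show "exp (- \<theta>) * measure (M' j) {..x} + (1 - measure (M' j) {..x}) \<le> exp (- (1 - exp (- \<theta>)) * f)"
        using exp_ge_add_one_self[of "- (1 - exp (- \<theta>)) * f"] by (simp add: algebra_simps)
    qed
    finally show ?thesis .
  qed
  have "emeasure (PiM I M') ?A = (\<integral>\<^sup>+ p. indicator ?A p \<partial>PiM I M')" using A by simp
  also have "\<dots> \<le> (\<integral>\<^sup>+ p. ennreal (exp (\<theta> * m)) * (\<Prod>j\<in>I. ennreal (g (p j))) \<partial>PiM I M')"
  proof (rule nn_integral_mono)
    fix p
    show "indicator ?A p \<le> ennreal (exp (\<theta> * m)) * (\<Prod>j\<in>I. ennreal (g (p j)))"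
    proof (cases "p \<in> ?A")
      case True
      then have "\<theta> * real (card {j\<in>I. p j \<le> x}) \<le> \<theta> * m" using \<theta> by (intro mult_left_mono) auto
      then have "1 \<le> exp (\<theta> * m) * exp (- \<theta> * real (card {j\<in>I. p j \<le> x}))"
        by (simp add: exp_add[symmetric])
      then have "ennreal 1 \<le> ennreal (exp (\<theta> * m)) * ennreal (exp (- \<theta> * real (card {j\<in>I. p j \<le> x})))"
        by (subst ennreal_mult[symmetric]) (auto intro: ennreal_leI)
      then show ?thesis unfolding prod by (simp add: indicator_def)
    qed simp
  qed
  also have "\<dots> = ennreal (exp (\<theta> * m)) * (\<integral>\<^sup>+ p. (\<Prod>j\<in>I. ennreal (g (p j))) \<partial>PiM I M')"
    by (rule nn_integral_cmult) measurable
  also have "(\<integral>\<^sup>+ p. (\<Prod>j\<in>I. ennreal (g (p j))) \<partial>PiM I M') = (\<Prod>j\<in>I. \<integral>\<^sup>+ y. ennreal (g y) \<partial>M' j)"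
    by (rule product_nn_integral_prod) (auto simp: fin)
  also have "\<dots> \<le> (\<Prod>j\<in>I. ennreal (exp (- (1 - exp (- \<theta>)) * f)))"
    by (intro prod_mono_ennreal int)
  also have "\<dots> = ennreal (exp (- (1 - exp (- \<theta>)) * real (card I) * f))"
    by (simp add: ennreal_power exp_of_nat_mult[symmetric] mult_ac)
  finally have "emeasure (PiM I M') ?A \<le> ennreal (exp (\<theta> * m)) * ennreal (exp (- (1 - exp (- \<theta>)) * real (card I) * f))"
    by (simp add: mult_left_mono)
  also have "\<dots> = ennreal (exp (\<theta> * m - (1 - exp (- \<theta>)) * real (card I) * f))"
    by (simp add: ennreal_mult[symmetric] exp_add[symmetric] algebra_simps)
  finally show ?thesis unfolding PiM by (simp add: emeasure_eq_measure)
qed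

section \<open>Marginal laws and the error under the alternative\<close>

text \<open>This is the law of \<open>- 2 * ln p\<close> for a single p-value, before
  \<open>alt_law\<close> maps it to the unit interval.\<close>

definition mixture :: "real \<Rightarrow> (real \<Rightarrow> real) \<Rightarrow> real measure" where
  "mixture \<epsilon> q = density lborel (\<lambda>u. ennreal ((1 - \<epsilon>) * chi2_2_density u + \<epsilon> * q u))"

lemma chi2_2_density_tail:
  assumes "0 \<le> c"
  shows "(\<integral>\<^sup>+ u. ennreal (chi2_2_density u) * indicator {c..} u \<partial>lborel) = ennreal (exp (- c / 2))"
proof -
  have "(\<integral>\<^sup>+ u. ennreal (chi2_2_density u) * indicator {c..} u \<partial>lborel)
      = (\<integral>\<^sup>+ u. ennreal (exp (- u / 2) / 2) * indicator {c..} u \<partial>lborel)"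
    \<comment> \<open>The density and its exponential formula differ at 0, a point of the domain
      when \<open>c = 0\<close>; hence equality almost everywhere.\<close>
    by (intro nn_integral_cong_AE, use AE_lborel_singleton[of 0] in eventually_elim)
      (use assms in \<open>auto simp: chi2_2_density_def split: split_indicator\<close>)
  also have "\<dots> = ennreal (0 - (- exp (- c / 2)))"
  proof (rule nn_integral_FTC_atLeast)
    show "((\<lambda>u. - exp (- u / 2)) has_real_derivative exp (- x / 2) / 2) (at x)" for x :: real
      by (auto intro!: derivative_eq_intros)
    show "((\<lambda>u::real. - exp (- u / 2)) \<longlongrightarrow> 0) at_top" by real_asymp
  qed auto
  finally show ?thesis by simp
qed

lemma chi2_2_density_measurable [measurable]: "chi2_2_density \<in> borel_measurable borel"
  unfolding chi2_2_density_def[abs_def] by measurable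

lemma emeasure_mixture_atLeast:
  assumes "0 \<le> \<epsilon>" "\<epsilon> \<le> 1" "0 \<le> c" and [measurable]: "q \<in> borel_measurable borel" and "\<And>u. 0 \<le> q u"
  shows "emeasure (mixture \<epsilon> q) {c..} = ennreal (1 - \<epsilon>) * ennreal (exp (- c / 2))
    + ennreal \<epsilon> * (\<integral>\<^sup>+ u. ennreal (q u) * indicator {c..} u \<partial>lborel)"
proof -
  have nn: "0 \<le> chi2_2_density u" for u by (simp add: chi2_2_density_def)
  have "emeasure (mixture \<epsilon> q) {c..}
      = (\<integral>\<^sup>+ u. ennreal ((1 - \<epsilon>) * chi2_2_density u + \<epsilon> * q u) * indicator {c..} u \<partial>lborel)"
    unfolding mixture_def by (subst emeasure_density) auto
  also have "\<dots> = (\<integral>\<^sup>+ u. ennreal (1 - \<epsilon>) * (ennreal (chi2_2_density u) * indicator {c..} u)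
      + ennreal \<epsilon> * (ennreal (q u) * indicator {c..} u) \<partial>lborel)"
    using assms nn by (intro nn_integral_cong) (auto simp: ennreal_plus ennreal_mult split: split_indicator)
  also have "\<dots> = ennreal (1 - \<epsilon>) * (\<integral>\<^sup>+ u. ennreal (chi2_2_density u) * indicator {c..} u \<partial>lborel)
      + ennreal \<epsilon> * (\<integral>\<^sup>+ u. ennreal (q u) * indicator {c..} u \<partial>lborel)"
    by (subst nn_integral_add) (auto simp: nn_integral_cmult)
  finally show ?thesis using chi2_2_density_tail[OF assms(3)] by simp
qed

lemma prob_space_mixture:
  assumes "0 \<le> \<epsilon>" "\<epsilon> \<le> 1" and [measurable]: "q \<in> borel_measurable borel" and "\<And>u. 0 \<le> q u"
    and "\<And>u. u \<le> 0 \<Longrightarrow> q u = 0" and "(\<integral>\<^sup>+ u. ennreal (q u) \<partial>lborel) = 1"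
  shows "prob_space (mixture \<epsilon> q)"
proof
  have *: "(\<integral>\<^sup>+ u. ennreal (q u) * indicator {0..} u \<partial>lborel) = 1"
    using assms(5) by (subst assms(6)[symmetric], intro nn_integral_cong) (auto split: split_indicator)
  \<comment> \<open>Both densities vanish on the negative axis, so the total mass is the tail at
    \<open>c = 0\<close>.\<close>
  have "emeasure (mixture \<epsilon> q) (space (mixture \<epsilon> q)) = emeasure (mixture \<epsilon> q) {0..}"
    unfolding mixture_def using assms(5)
    by (auto simp: emeasure_density chi2_2_density_def intro!: nn_integral_cong split: split_indicator)
  also have "\<dots> = ennreal (1 - \<epsilon>) + ennreal \<epsilon>"
    using emeasure_mixture_atLeast[OF assms(1,2) order_refl assms(3,4)] * by simp
  also have "\<dots> = 1" using assms by (subst ennreal_plus[symmetric]) auto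
  finally show "emeasure (mixture \<epsilon> q) (space (mixture \<epsilon> q)) = 1" .
qed

text \<open>The p-value is at most \<open>t\<close> exactly when \<open>u \<ge> - 2 * ln t\<close>;
  the chi-squared component has mass exactly \<open>t\<close> there, and \<open>g\<close> bounds the
  mass of the other component.\<close>

lemma mixture_distr_cdf_ge:
  assumes "0 \<le> \<epsilon>" "\<epsilon> \<le> 1" and [measurable]: "q \<in> borel_measurable borel" and "\<And>u. 0 \<le> q u"
    and "\<And>u. u \<le> 0 \<Longrightarrow> q u = 0" and "(\<integral>\<^sup>+ u. ennreal (q u) \<partial>lborel) = 1"
    and t: "0 < t" "t \<le> 1" and g: "0 \<le> g" "ennreal g \<le> (\<integral>\<^sup>+ u. ennreal (q u) * indicator {- 2 * ln t..} u \<partial>lborel)"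
  shows "(1 - \<epsilon>) * t + \<epsilon> * g \<le> measure (distr (mixture \<epsilon> q) borel (\<lambda>u. exp (- u / 2))) {..t}"
proof -
  interpret prob_space "mixture \<epsilon> q" by (rule prob_space_mixture[OF assms(1-6)])
  have sets: "sets (mixture \<epsilon> q) = sets borel" by (simp add: mixture_def)
  have "exp (- u / 2) \<le> t \<longleftrightarrow> - 2 * ln t \<le> u" for u
    using ln_ge_iff[of t "- u / 2"] t by auto
  then have vimage: "(\<lambda>u. exp (- u / 2)) -` {..t} \<inter> space (mixture \<epsilon> q) = {- 2 * ln t..}"
    by (auto simp: mixture_def)
  have "ennreal ((1 - \<epsilon>) * t + \<epsilon> * g) = ennreal (1 - \<epsilon>) * ennreal t + ennreal \<epsilon> * ennreal g"
    using assms by (simp add: ennreal_plus ennreal_mult)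
  also have "\<dots> \<le> ennreal (1 - \<epsilon>) * ennreal t
     + ennreal \<epsilon> * (\<integral>\<^sup>+ u. ennreal (q u) * indicator {- 2 * ln t..} u \<partial>lborel)"
    by (intro add_mono mult_left_mono g) auto
  also have "\<dots> = emeasure (mixture \<epsilon> q) {- 2 * ln t..}"
    using emeasure_mixture_atLeast[of \<epsilon> "- 2 * ln t" q] assms t by simp
  also have "\<dots> = emeasure (distr (mixture \<epsilon> q) borel (\<lambda>u. exp (- u / 2))) {..t}"
    unfolding vimage[symmetric] by (subst emeasure_distr) (auto simp: measurable_cong_sets[OF sets refl])
  also have "\<dots> = ennreal (measure (distr (mixture \<epsilon> q) borel (\<lambda>u. exp (- u / 2))) {..t})"
    by (intro finite_measure.emeasure_eq_measure prob_space.finite_measure prob_space_distr)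
      (simp add: measurable_cong_sets[OF sets refl])
  finally show ?thesis by simp
qed

text \<open>If \<open>i\<close> is the count itself, the \<open>i\<close>-th order statistic is at
  most \<open>t\<close>, so \<open>bj_pi\<close> is at most the tail at \<open>t\<close>, which lies
  below \<open>h\<close> once the count reaches \<open>m\<close>. A large statistic thus forces a
  count below \<open>m\<close>, which the lower-tail bound controls.\<close>

lemma berk_jones_alt_bound:
  assumes "1 \<le> n" and \<epsilon>: "0 \<le> \<epsilon>" "\<epsilon> \<le> 1"
    and q_meas: "\<And>i. i \<in> {1..n} \<Longrightarrow> q i \<in> borel_measurable borel"
    and q_nonneg: "\<And>i u. i \<in> {1..n} \<Longrightarrow> 0 \<le> q i u"
    and q_supp: "\<And>i u. i \<in> {1..n} \<Longrightarrow> u \<le> 0 \<Longrightarrow> q i u = 0"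
    and q_prob: "\<And>i. i \<in> {1..n} \<Longrightarrow> (\<integral>\<^sup>+ u. ennreal (q i u) \<partial>lborel) = 1"
    and t: "0 < t" "t \<le> 1" and g: "0 \<le> g"
    and tail: "\<And>i. i \<in> {1..n} \<Longrightarrow> ennreal g \<le> (\<integral>\<^sup>+ u. ennreal (q i u) * indicator {- 2 * ln t..} u \<partial>lborel)"
    and \<theta>: "0 \<le> \<theta>" and m: "0 < m"
    and h: "\<And>k. m \<le> real k \<Longrightarrow> bin_tail n k t < h"
  shows "measure (alt_law \<epsilon> q n) {p \<in> space (alt_law \<epsilon> q n). h \<le> berk_jones n p}
    \<le> exp (\<theta> * m - (1 - exp (- \<theta>)) * real n * ((1 - \<epsilon>) * t + \<epsilon> * g))"
proof -
  define M where "M i = distr (mixture \<epsilon> (q i)) borel (\<lambda>u. exp (- u / 2))" for i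
  let ?P = "PiM {1..n} M" and ?N = "\<lambda>p. card {j\<in>{1..n}. p j \<le> t}"
  have P: "alt_law \<epsilon> q n = ?P" by (simp add: alt_law_def M_def[abs_def] mixture_def)
  have exp_meas: "(\<lambda>u. exp (- u / 2)) \<in> measurable (mixture \<epsilon> q') borel" for q'
    by (simp add: mixture_def)
  have M_prob: "prob_space (M i)" if "i \<in> {1..n}" for i
    unfolding M_def by (intro prob_space.prob_space_distr prob_space_mixture exp_meas)
      (use \<epsilon> q_meas q_nonneg q_supp q_prob that in auto)
  have M_sets: "sets (M i) = sets borel" for i by (simp add: M_def)
  have M_cdf: "(1 - \<epsilon>) * t + \<epsilon> * g \<le> measure (M i) {..t}" if "i \<in> {1..n}" for i
    unfolding M_def using that
    by (intro mixture_distr_cdf_ge \<epsilon> q_meas q_nonneg q_supp q_prob t g tail)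
  have M_pos: "AE y in M i. 0 < y" for i
    unfolding M_def by (subst AE_distr_iff[OF exp_meas]) auto
  interpret prob_space ?P by (intro prob_space_PiM M_prob)
  have pos: "AE p in ?P. \<forall>j\<in>{1..n}. 0 < p j"
    by (intro AE_finite_allI AE_PiM_component M_prob M_pos) auto
  have meas: "{p \<in> space ?P. real (?N p) < m} \<in> events"
  proof -
    have eq: "{p \<in> space ?P. real (?N p) < m} = space ?P - {p \<in> space ?P. nat \<lceil>m\<rceil> \<le> ?N p}"
      by (auto simp: nat_le_iff ceiling_le_iff not_le)
    show ?thesis unfolding eq by (intro sets.Diff sets.top count_event_sets) (auto simp: M_sets)
  qed
  have "prob {p \<in> space ?P. h \<le> berk_jones n p} \<le> prob {p \<in> space ?P. real (?N p) < m}"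
  proof (rule finite_measure_mono_AE[OF _ meas])
    show "AE p in ?P. p \<in> {p \<in> space ?P. h \<le> berk_jones n p} \<longrightarrow> p \<in> {p \<in> space ?P. real (?N p) < m}"
      using pos
    proof eventually_elim
      case (elim p)
      have "berk_jones n p < h" if N: "m \<le> real (?N p)"
      proof -
        define i where "i = ?N p"
        have "i \<le> card {1..n}" unfolding i_def by (rule card_mono) auto
        \<comment> \<open>Positivity of \<open>m\<close> excludes the index 0, which has no order
          statistic.\<close>
        moreover have "0 < i" using N m by (simp add: i_def)
        ultimately have i: "i \<in> {1..n}" by simp
        have le: "order_stat n p i \<le> t" using order_stat_le_iff[OF i, of p t] by (simp add: i_def)
        have gt: "0 < order_stat n p i" using order_stat_mem[OF i, of p] elim by auto
        have "berk_jones n p \<le> bj_pi n p i"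
          using i unfolding berk_jones_def by (intro min.coboundedI1 Min_le) auto
        also have "\<dots> = bin_tail n i (order_stat n p i)" by (rule bj_pi_eq[OF i])
        also have "\<dots> \<le> bin_tail n i t" using i le gt t by (intro bin_tail_mono) auto
        also have "\<dots> < h" using h N by (simp add: i_def)
        finally show ?thesis .
      qed
      then show ?case by force
    qed
  qed
  also have "\<dots> \<le> exp (\<theta> * m - (1 - exp (- \<theta>)) * real (card {1..n}) * ((1 - \<epsilon>) * t + \<epsilon> * g))"
    by (intro count_lower_tail_chernoff M_prob M_sets M_cdf \<theta>) auto
  finally show ?thesis by (simp add: P)
qed

section \<open>Exponents available above the detection boundary\<close>

text \<open>
  Below, \<open>s'\<close> is where the component \<open>Q\<close> has its mass: it is \<open>s\<close> itself, except that it moves to \<open>r\<close>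
  when \<open>r > s\<close>. The first case of the proof takes the maximiser of
  \<open>s / 2 - (\<surd>s - \<surd>r)\<^sup>2 / \<sigma>\<^sup>2\<close>, after lowering \<open>r\<close> so that it is at most 1; the others take \<open>s = 1\<close>.
\<close>

lemma rho_less_room:
  assumes \<beta>: "1/2 < \<beta>" "\<beta> < 1" and r: "0 < r" and \<sigma>: "0 < \<sigma>" and above: "rho \<beta> \<sigma> < r"
  obtains s s' where "0 < s" "s \<le> 1" "s \<le> s'" "(sqrt s' - sqrt r)\<^sup>2 / \<sigma>\<^sup>2 < s / 2 - (\<beta> - 1/2)"
proof -
  note witness = that
  \<comment> \<open>It suffices to treat a smaller \<open>r\<^sub>0 \<le> s\<close> with
    \<open>s' = s\<close>. Passing back to \<open>r\<close>, the distance shrinks if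
    \<open>r \<le> s\<close> and becomes 0 if \<open>r > s\<close>.\<close>
  have reduce: thesis
    if s: "0 < s" "s \<le> 1" and r\<^sub>0: "r\<^sub>0 \<le> r" "r\<^sub>0 \<le> s"
      and room: "(sqrt s - sqrt r\<^sub>0)\<^sup>2 / \<sigma>\<^sup>2 < s / 2 - (\<beta> - 1/2)" for s r\<^sub>0
  proof (rule witness[of s "max s r"])
    have "(sqrt (max s r) - sqrt r)\<^sup>2 \<le> (sqrt s - sqrt r\<^sub>0)\<^sup>2"
    proof (rule power_mono)
      show "sqrt (max s r) - sqrt r \<le> sqrt s - sqrt r\<^sub>0"
        using r\<^sub>0 by (auto simp: max_def)
    qed simp
    then have "(sqrt (max s r) - sqrt r)\<^sup>2 / \<sigma>\<^sup>2 \<le> (sqrt s - sqrt r\<^sub>0)\<^sup>2 / \<sigma>\<^sup>2"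
      by (intro divide_right_mono) auto
    with room show "(sqrt (max s r) - sqrt r)\<^sup>2 / \<sigma>\<^sup>2 < s / 2 - (\<beta> - 1/2)" by simp
  qed (use s in auto)
  show thesis
  proof (cases "\<sigma>\<^sup>2 < 2 \<and> \<beta> < 1 - \<sigma>\<^sup>2 / 4")
    case True
    define w where "w = 2 - \<sigma>\<^sup>2"
    have w: "0 < w" "w < 2" using True \<sigma> by (auto simp: w_def)
    define r\<^sub>0 where "r\<^sub>0 = min r (w\<^sup>2 / 4)"
    have "\<beta> - 1/2 < w / 4" using True by (simp add: w_def)
    then have "w * (\<beta> - 1/2) < w * (w / 4)" using w by (intro mult_strict_left_mono) auto
    \<comment> \<open>Both entries of the minimum exceed \<open>w * (\<beta> - 1/2)\<close>:
      \<open>r\<close> because it is above \<open>rho\<close>, and \<open>w\<^sup>2 / 4\<close> by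
      the case assumption on \<open>\<beta>\<close>.\<close>
    then have room: "w * (\<beta> - 1/2) < r\<^sub>0"
      using above True by (auto simp: r\<^sub>0_def rho_def w_def power2_eq_square)
    have r\<^sub>0: "0 < r\<^sub>0" "r\<^sub>0 \<le> r" "4 * r\<^sub>0 \<le> w\<^sup>2" using r w by (auto simp: r\<^sub>0_def)
    define s where "s = 4 * r\<^sub>0 / w\<^sup>2"
    have sqrt_s: "sqrt s = 2 * sqrt r\<^sub>0 / w" using w by (simp add: s_def real_sqrt_divide real_sqrt_mult)
    have "sqrt s - sqrt r\<^sub>0 = \<sigma>\<^sup>2 * sqrt r\<^sub>0 / w" unfolding sqrt_s using w by (simp add: w_def field_simps)
    then have "(sqrt s - sqrt r\<^sub>0)\<^sup>2 / \<sigma>\<^sup>2 = \<sigma>\<^sup>2 * r\<^sub>0 / w\<^sup>2"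
      using r\<^sub>0 \<sigma> by (simp add: power_mult_distrib power_divide) (simp add: power2_eq_square power4_eq_xxxx)
    also have "\<dots> = (2 - w) * r\<^sub>0 / w\<^sup>2" by (simp add: w_def)
    \<comment> \<open>At the maximiser the difference of \<open>s / 2\<close> and the quadratic cost
      is \<open>r\<^sub>0 / w\<close>, so the requirement is precisely \<open>room\<close>.\<close>
    also have "\<dots> = s / 2 - r\<^sub>0 / w" using w by (simp add: s_def field_simps power2_eq_square)
    also have "\<dots> < s / 2 - (\<beta> - 1/2)" using room w by (simp add: field_simps)
    finally have main: "(sqrt s - sqrt r\<^sub>0)\<^sup>2 / \<sigma>\<^sup>2 < s / 2 - (\<beta> - 1/2)" .
    have "w\<^sup>2 \<le> 2\<^sup>2" using w by (intro power_mono) auto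
    then have "r\<^sub>0 * w\<^sup>2 \<le> r\<^sub>0 * 4" using r\<^sub>0 by (intro mult_left_mono) auto
    then have "r\<^sub>0 \<le> s" using w by (simp add: s_def field_simps)
    then show thesis using r\<^sub>0 w main by (intro reduce[of s r\<^sub>0]) (auto simp: s_def field_simps)
  next
    case False
    define y where "y = \<sigma> * sqrt (1 - \<beta>)"
    have y: "0 < y" "y\<^sup>2 = \<sigma>\<^sup>2 * (1 - \<beta>)" using \<beta> \<sigma> by (auto simp: y_def power_mult_distrib)
    \<comment> \<open>At \<open>s = 1\<close> the requirement is that the distance from 1 to
      \<open>sqrt (min r 1)\<close> be below \<open>y\<close>. On the zero branch of
      \<open>rho\<close> one has \<open>y > 1\<close>; on the remaining branches \<open>rho\<close>
      is \<open>(1 - y)\<^sup>2\<close>.\<close>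
    have "1 - y < sqrt r"
    proof (cases "\<sigma>\<^sup>2 \<ge> 2 \<and> \<beta> < 1 - 1 / \<sigma>\<^sup>2")
      case True
      then have "1 < \<sigma>\<^sup>2 * (1 - \<beta>)" using \<sigma> by (simp add: field_simps)
      then have "1 < y" using y power_le_one[of y 2] by force
      then show ?thesis using r by (smt (verit) real_sqrt_gt_zero)
    next
      case F: False
      then have "rho \<beta> \<sigma> = (1 - y)\<^sup>2" using False by (auto simp: rho_def y_def)
      then show ?thesis using above by (intro real_less_rsqrt) simp
    qed
    then have "\<bar>1 - sqrt (min r 1)\<bar> < y" using y r by (auto simp: min_def)
    then have "(1 - sqrt (min r 1))\<^sup>2 < y\<^sup>2" by (metis abs_ge_zero power2_abs power_strict_mono zero_less_numeral)
    then have "(1 - sqrt (min r 1))\<^sup>2 / \<sigma>\<^sup>2 < 1 - \<beta>" using y \<sigma> by (simp add: field_simps)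
    then show thesis by (intro reduce[of 1 "min r 1"]) auto
  qed
qed

section \<open>Tail mass from the APLC condition\<close>

text \<open>The positive square root alone gives the bound. Argument and mean both scale like
  \<open>sqrt L\<close>, so the Gaussian exponent is linear in \<open>L\<close>, a power of
  \<open>n\<close> when \<open>L = ln n\<close>.\<close>

lemma chi2nc_density_ge:
  assumes "0 < \<sigma>" "0 < r" "0 < q" "0 < L"
  shows "exp (- ((sqrt q - sqrt (2 * r))\<^sup>2 / (2 * \<sigma>\<^sup>2)) * L) / (2 * sqrt (2 * pi * \<sigma>\<^sup>2) * sqrt (q * L))
    \<le> chi2nc_density (sqrt (2 * r * L)) \<sigma> (q * L)"
proof -
  have "(sqrt (q * L) - sqrt (2 * r * L))\<^sup>2 = (sqrt q - sqrt (2 * r))\<^sup>2 * L"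
  proof -
    have "(sqrt (q * L) - sqrt (2 * r * L))\<^sup>2 = ((sqrt q - sqrt (2 * r)) * sqrt L)\<^sup>2"
      by (simp only: real_sqrt_mult left_diff_distrib)
    then show ?thesis using assms by (simp add: power_mult_distrib)
  qed
  then have "normal_density (sqrt (2 * r * L)) \<sigma> (sqrt (q * L)) / (2 * sqrt (q * L))
    = exp (- ((sqrt q - sqrt (2 * r))\<^sup>2 / (2 * \<sigma>\<^sup>2)) * L) / (2 * sqrt (2 * pi * \<sigma>\<^sup>2) * sqrt (q * L))"
    unfolding normal_density_def by simp
  moreover have "normal_density (sqrt (2 * r * L)) \<sigma> (sqrt (q * L)) / (2 * sqrt (q * L))
      \<le> chi2nc_density (sqrt (2 * r * L)) \<sigma> (q * L)"
    using assms by (simp add: chi2nc_density_def divide_right_mono normal_density_nonneg)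
  ultimately show ?thesis by simp
qed

context
  fixes r \<sigma> :: real and Q :: "nat \<Rightarrow> nat \<Rightarrow> real \<Rightarrow> real"
  assumes r: "r > 0" and \<sigma>: "\<sigma> > 0"
    and Q_meas: "\<And>n i. i \<in> {1..n} \<Longrightarrow> Q n i \<in> borel_measurable borel"
    and APLC: "\<And>q. q > 0 \<Longrightarrow>
        (\<forall>\<^sub>F n in sequentially. \<forall>i\<in>{1..n}. Q n i (q * ln (real n)) > 0) \<and>
        (\<lambda>n. (1 / ln (real n)) *
              Max ((\<lambda>i. \<bar>ln (Q n i (q * ln (real n)) /
                     chi2nc_density (sqrt (2 * r * ln (real n))) \<sigma> (q * ln (real n)))\<bar>) ` {1..n}))
          \<longlonglongrightarrow> 0"
begin

lemma APLC_density_ge: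
  assumes q: "0 < q" and \<kappa>: "(sqrt q - sqrt (2 * r))\<^sup>2 / (2 * \<sigma>\<^sup>2) < \<kappa>"
  shows "\<forall>\<^sub>F n in sequentially. \<forall>i\<in>{1..n}. real n powr - \<kappa> \<le> Q n i (q * ln (real n))"
proof -
  define e where "e = (sqrt q - sqrt (2 * r))\<^sup>2 / (2 * \<sigma>\<^sup>2)"
  \<comment> \<open>Half of the gap between \<open>\<kappa>\<close> and the Gaussian exponent
    \<open>e\<close> pays for the APLC density ratio, the other half for the factor
    \<open>K * sqrt (q * ln n)\<close>.\<close>
  define \<delta> where "\<delta> = (\<kappa> - e) / 2"
  define K where "K = 2 * sqrt (2 * pi * \<sigma>\<^sup>2)"
  have \<delta>: "0 < \<delta>" using \<kappa> by (simp add: \<delta>_def e_def)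
  have K: "0 < K" using \<sigma> by (simp add: K_def)
  let ?c = "\<lambda>n. chi2nc_density (sqrt (2 * r * ln (real n))) \<sigma> (q * ln (real n))"
  let ?m = "\<lambda>n. Max ((\<lambda>i. \<bar>ln (Q n i (q * ln (real n)) / ?c n)\<bar>) ` {1..n})"
  have "\<forall>\<^sub>F n in sequentially. (1 / ln (real n)) * ?m n < \<delta>"
    using APLC[OF q] \<delta> by (blast dest: order_tendstoD)
  moreover have "\<forall>\<^sub>F n in sequentially. \<forall>i\<in>{1..n}. Q n i (q * ln (real n)) > 0"
    using APLC[OF q] by blast
  moreover have "\<forall>\<^sub>F n in sequentially. exp (- \<delta> * ln (real n)) * (K * sqrt (q * ln (real n))) < 1"
    using \<delta> K q by real_asymp
  moreover have "\<forall>\<^sub>F n in sequentially. 2 \<le> n" by (rule eventually_ge_at_top)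
  ultimately show ?thesis
  proof eventually_elim
    case (elim n)
    define L where "L = ln (real n)"
    have L: "0 < L" using elim(4) by (simp add: L_def)
    show ?case
    proof
      fix i assume i: "i \<in> {1..n}"
      have c: "exp (- e * L) / (K * sqrt (q * L)) \<le> ?c n"
        using chi2nc_density_ge[OF \<sigma> r q L] unfolding e_def K_def L_def by simp
      have "0 < exp (- e * L) / (K * sqrt (q * L))" using K q L by simp
      with c have c_pos: "0 < ?c n" by linarith
      have Q_pos: "0 < Q n i (q * L)" using elim(2) i by (simp add: L_def)
      have "\<bar>ln (Q n i (q * L) / ?c n)\<bar> \<le> ?m n" using i unfolding L_def by (intro Max_ge) auto
      also have "\<dots> < \<delta> * L" using elim(1) L by (simp add: L_def field_simps)
      finally have "- (\<delta> * L) < ln (Q n i (q * L) / ?c n)" by linarith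
      then have "exp (- (\<delta> * L)) < Q n i (q * L) / ?c n"
        using Q_pos c_pos by (metis divide_pos_pos exp_less_cancel_iff exp_ln)
      then have "exp (- (\<delta> * L)) * ?c n < Q n i (q * L)" using c_pos by (simp add: field_simps)
      moreover have "exp (- (\<delta> * L)) * (exp (- e * L) / (K * sqrt (q * L))) \<le> exp (- (\<delta> * L)) * ?c n"
        using c by (intro mult_left_mono) auto
      moreover have "exp (- \<kappa> * L) \<le> exp (- (\<delta> * L)) * (exp (- e * L) / (K * sqrt (q * L)))"
      proof -
        have "exp (- \<kappa> * L) * (K * sqrt (q * L))
            = exp (- (\<delta> * L)) * exp (- e * L) * (exp (- \<delta> * L) * (K * sqrt (q * L)))"
          by (simp add: exp_add[symmetric] \<delta>_def field_simps)
        also have "\<dots> \<le> exp (- (\<delta> * L)) * exp (- e * L) * 1"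
          using elim(3) by (intro mult_left_mono) (auto simp: L_def)
        finally show ?thesis using K q L by (simp add: field_simps)
      qed
      ultimately have "exp (- \<kappa> * L) \<le> Q n i (q * L)" by linarith
      then show "real n powr - \<kappa> \<le> Q n i (q * ln (real n))"
        using elim(4) by (simp add: powr_def L_def)
    qed
  qed
qed

text \<open>
  The APLC condition is only pointwise in \<open>q\<close>; dominated convergence turns it into a lower bound on
  a set of \<open>q\<close> of nearly full measure, which suffices for the tail integral.
\<close>

lemma APLC_tail_ge:
  assumes s: "0 < s" "s \<le> s'" and \<kappa>: "(sqrt s' - sqrt r)\<^sup>2 / \<sigma>\<^sup>2 < \<kappa>"
  shows "\<forall>\<^sub>F n in sequentially. \<forall>i\<in>{1..n}.
    ennreal (real n powr - \<kappa>) \<le> (\<integral>\<^sup>+ u. ennreal (Q n i u) * indicator {2 * s * ln (real n)..} u \<partial>lborel)"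
proof -
  let ?e = "\<lambda>q. (sqrt q - sqrt (2 * r))\<^sup>2 / (2 * \<sigma>\<^sup>2)"
  \<comment> \<open>The level \<open>n powr - s'\<close> for p-values corresponds to
    \<open>u = 2 * s' * ln n\<close>, that is, to \<open>q = 2 * s'\<close>.\<close>
  have "?e (2 * s') = (sqrt 2 * (sqrt s' - sqrt r))\<^sup>2 / (2 * \<sigma>\<^sup>2)"
    by (simp only: real_sqrt_mult right_diff_distrib)
  also have "\<dots> = (sqrt s' - sqrt r)\<^sup>2 / \<sigma>\<^sup>2" by (simp add: power_mult_distrib)
  finally have e: "?e (2 * s') < \<kappa>" using \<kappa> by simp
  \<comment> \<open>Continuity keeps the exponent below \<open>\<kappa>\<close> on a whole interval
    to the right of \<open>2 * s'\<close>, which has positive length to integrate over.\<close>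
  have "(?e \<longlongrightarrow> ?e (2 * s')) (at_right (2 * s'))"
    using \<sigma> by (intro tendsto_intros) auto
  from order_tendstoD(2)[OF this e] obtain b where b: "2 * s' < b"
    and b': "\<And>q. 2 * s' < q \<Longrightarrow> q < b \<Longrightarrow> ?e q < \<kappa>"
    by (auto simp: eventually_at_right_field)
  define B where "B n = {q \<in> {2 * s'<..<b}. \<forall>i\<in>{1..n}. real n powr - \<kappa> \<le> Q n i (q * ln (real n))}" for n
  have B_meas [measurable]: "B n \<in> sets borel" for n
  proof -
    have 1: "{q. real n powr - \<kappa> \<le> Q n i (q * ln (real n))} \<in> sets borel" if "i \<in> {1..n}" for i
    proof -
      note [measurable] = Q_meas[OF that]
      show ?thesis by measurable
    qed
    have "B n = {2 * s'<..<b} \<inter> (\<Inter>i\<in>{1..n}. {q. real n powr - \<kappa> \<le> Q n i (q * ln (real n))})"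
      by (auto simp: B_def)
    also have "\<dots> \<in> sets borel"
    \<comment> \<open>For \<open>n = 0\<close> the intersection runs over an empty family and is
      \<open>UNIV\<close>.\<close>
    proof (cases "n = 0")
      case False
      then show ?thesis by (intro sets.Int sets.finite_INT 1) simp_all
    qed simp
    finally show ?thesis .
  qed
  have "(\<lambda>n. \<integral>q. (indicator (B n) q :: real) \<partial>lborel) \<longlonglongrightarrow> (\<integral>q. indicator {2 * s'<..<b} q \<partial>lborel)"
  proof (rule integral_dominated_convergence[where w = "indicator {2 * s'<..<b}"])
    show "AE q in lborel. (\<lambda>n. indicator (B n) q) \<longlonglongrightarrow> (indicator {2 * s'<..<b} q :: real)"
    proof (rule AE_I2)
      fix q :: real
      show "(\<lambda>n. indicator (B n) q) \<longlonglongrightarrow> (indicator {2 * s'<..<b} q :: real)"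
      proof (cases "q \<in> {2 * s'<..<b}")
        case True
        have "\<forall>\<^sub>F n in sequentially. \<forall>i\<in>{1..n}. real n powr - \<kappa> \<le> Q n i (q * ln (real n))"
          using True s b' by (intro APLC_density_ge) auto
        then have "\<forall>\<^sub>F n in sequentially. indicator (B n) q = (1 :: real)"
          by eventually_elim (use True in \<open>auto simp: B_def\<close>)
        then show ?thesis using True by (simp add: tendsto_eventually)
      next
        case False
        then have "q \<notin> B n" for n by (auto simp: B_def)
        then show ?thesis using False by simp
      qed
    qed
    show "AE q in lborel. norm (indicator (B n) q :: real) \<le> indicator {2 * s'<..<b} q" for n
      by (rule AE_I2) (auto simp: B_def split: split_indicator)
  qed (use b in auto)
  then have "(\<lambda>n. measure lborel (B n)) \<longlonglongrightarrow> b - 2 * s'" using b by simp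
  then have "\<forall>\<^sub>F n in sequentially. (b - 2 * s') / 2 < measure lborel (B n)"
    using b by (intro order_tendstoD) auto
  \<comment> \<open>The Jacobian \<open>ln n\<close> of the substitution \<open>u = ln n * q\<close>
    outgrows the inverse of the measure of \<open>B n\<close>, so the tail bound carries no
    constant.\<close>
  moreover have "\<forall>\<^sub>F n in sequentially. 1 < ln (real n) * ((b - 2 * s') / 2)"
    using b by real_asymp
  moreover have "\<forall>\<^sub>F n in sequentially. 2 \<le> n" by (rule eventually_ge_at_top)
  ultimately show ?thesis
  proof eventually_elim
    case (elim n)
    define L where "L = ln (real n)"
    have L: "0 < L" using elim(3) by (simp add: L_def)
    show ?case
    proof
      fix i assume i: "i \<in> {1..n}"
      note [measurable] = Q_meas[OF i]
      have "emeasure lborel (B n) \<le> emeasure lborel {2 * s'<..<b}" by (intro emeasure_mono) (auto simp: B_def)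
      then have fin: "emeasure lborel (B n) < \<infinity>" using b by (simp add: le_less_trans)
      have "1 \<le> L * measure lborel (B n)"
        using elim(2) mult_strict_left_mono[OF elim(1) L] unfolding L_def by linarith
      then have "ennreal (real n powr - \<kappa>) \<le> ennreal (L * (real n powr - \<kappa> * measure lborel (B n)))"
        using mult_left_mono[of 1 "L * measure lborel (B n)" "real n powr - \<kappa>"]
        by (intro ennreal_leI) (simp add: mult_ac)
      also have "\<dots> = ennreal L * (ennreal (real n powr - \<kappa>) * emeasure lborel (B n))"
        using L fin by (simp add: ennreal_mult emeasure_eq_ennreal_measure)
      also have "\<dots> = ennreal L * (\<integral>\<^sup>+ q. ennreal (real n powr - \<kappa>) * indicator (B n) q \<partial>lborel)"
        by (simp add: nn_integral_cmult_indicator)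
      also have "\<dots> \<le> ennreal L * (\<integral>\<^sup>+ q. ennreal (Q n i (0 + L * q)) * indicator {2 * s * L..} (0 + L * q) \<partial>lborel)"
      proof (intro mult_left_mono nn_integral_mono)
        fix q
        show "ennreal (real n powr - \<kappa>) * indicator (B n) q
            \<le> ennreal (Q n i (0 + L * q)) * indicator {2 * s * L..} (0 + L * q)"
        proof (cases "q \<in> B n")
          case True
          then have "real n powr - \<kappa> \<le> Q n i (q * L)" and "2 * s \<le> q"
            using i s by (auto simp: B_def L_def)
          moreover from this(2) have "2 * s * L \<le> L * q" using L by (simp add: mult.commute)
          ultimately show ?thesis using True by (simp add: mult.commute ennreal_leI)
        qed simp
      qed simp
      also have "\<dots> = (\<integral>\<^sup>+ u. ennreal (Q n i u) * indicator {2 * s * L..} u \<partial>lborel)"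
        using L by (subst nn_integral_real_affine[where c=L and t=0]) auto
      finally show "ennreal (real n powr - \<kappa>)
          \<le> (\<integral>\<^sup>+ u. ennreal (Q n i u) * indicator {2 * s * ln (real n)..} u \<partial>lborel)"
        by (simp add: L_def)
    qed
  qed
qed

end

section \<open>Choice of parameters and the limit\<close>

text \<open>These keep the Chernoff exponents to second order. The second bound follows from
  \<open>exp (- x) * (1 + x) \<le> 1\<close> and
  \<open>(1 - x + x\<^sup>2) * (1 + x) = 1 + x ^ 3\<close>.\<close>

lemma exp_le_quadratic:
  fixes x :: real
  assumes "0 \<le> x" "x \<le> 1"
  shows "exp x - 1 \<le> x + x\<^sup>2" and "x - x\<^sup>2 \<le> 1 - exp (- x)"
proof -
  show "exp x - 1 \<le> x + x\<^sup>2" using exp_bound[OF assms] by simp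
  have "exp (- x) * (1 + x) \<le> exp (- x) * exp x"
    using exp_ge_add_one_self[of x] by (intro mult_left_mono) auto
  then have "exp (- x) * (1 + x) \<le> 1" by (simp add: exp_add[symmetric])
  moreover have "1 \<le> (1 - x + x\<^sup>2) * (1 + x)"
    using assms by (simp add: algebra_simps power2_eq_square)
  ultimately have "exp (- x) * (1 + x) \<le> (1 - x + x\<^sup>2) * (1 + x)" by linarith
  then have "exp (- x) \<le> 1 - x + x\<^sup>2" using assms by simp
  then show "x - x\<^sup>2 \<le> 1 - exp (- x)" by simp
qed

theorem theorem3:
  fixes \<beta> r \<sigma> :: real
    and Q :: "nat \<Rightarrow> nat \<Rightarrow> real \<Rightarrow> real"
  assumes \<beta>: "1/2 < \<beta>" "\<beta> < 1"
    and r: "r > 0" and \<sigma>: "\<sigma> > 0"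
    and Q_meas: "\<And>n i. i \<in> {1..n} \<Longrightarrow> Q n i \<in> borel_measurable borel"
    and Q_nonneg: "\<And>n i u. i \<in> {1..n} \<Longrightarrow> Q n i u \<ge> 0"
    and Q_supp: "\<And>n i u. i \<in> {1..n} \<Longrightarrow> u \<le> 0 \<Longrightarrow> Q n i u = 0"
    and Q_prob: "\<And>n i. i \<in> {1..n} \<Longrightarrow> (\<integral>\<^sup>+ u. ennreal (Q n i u) \<partial>lborel) = 1"
    and APLC: "\<And>q. q > 0 \<Longrightarrow>
        (\<forall>\<^sub>F n in sequentially. \<forall>i\<in>{1..n}. Q n i (q * ln (real n)) > 0) \<and>
        (\<lambda>n. (1 / ln (real n)) *
              Max ((\<lambda>i. \<bar>ln (Q n i (q * ln (real n)) /
                     chi2nc_density (sqrt (2 * r * ln (real n))) \<sigma> (q * ln (real n)))\<bar>) ` {1..n}))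
          \<longlonglongrightarrow> 0"
    and above: "r > rho \<beta> \<sigma>"
  shows "\<exists>h :: nat \<Rightarrow> real.
     (\<lambda>n. measure (null_law n) {p \<in> space (null_law n). berk_jones n p < h n}
        + measure (alt_law (real n powr (- \<beta>)) (Q n) n)
            {p \<in> space (alt_law (real n powr (- \<beta>)) (Q n) n). berk_jones n p \<ge> h n})
     \<longlonglongrightarrow> 0"
proof -
  obtain s s' where s: "0 < s" "s \<le> 1" "s \<le> s'"
    and room: "(sqrt s' - sqrt r)\<^sup>2 / \<sigma>\<^sup>2 < s / 2 - (\<beta> - 1/2)"
    using rho_less_room[OF \<beta> r \<sigma> above] by blast
  obtain \<kappa> where \<kappa>: "(sqrt s' - sqrt r)\<^sup>2 / \<sigma>\<^sup>2 < \<kappa>" "\<kappa> < s / 2 - (\<beta> - 1/2)"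
    using dense[OF room] by blast
  have \<kappa>_less: "\<kappa> < s" using \<kappa>(2) \<beta> s by linarith
  \<comment> \<open>Up to constants, \<open>n powr \<gamma>\<close> is the excess
    \<open>n powr (1 - \<beta> - \<kappa>)\<close> divided by the null standard deviation scale
    \<open>n powr ((1 - s) / 2)\<close>.\<close>
  define \<gamma> where "\<gamma> = 1/2 - \<beta> - \<kappa> + s / 2"
  have \<gamma>: "0 < \<gamma>" using \<kappa>(2) by (simp add: \<gamma>_def)
  define bound where "bound n = 2 / real n + exp (1 / 16 - real n powr \<gamma> / 32)" for n :: nat
  let ?err = "\<lambda>n. measure (null_law n) {p \<in> space (null_law n). berk_jones n p < 1 / (real n)\<^sup>2}
        + measure (alt_law (real n powr (- \<beta>)) (Q n) n)
            {p \<in> space (alt_law (real n powr (- \<beta>)) (Q n) n). berk_jones n p \<ge> 1 / (real n)\<^sup>2}"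
  have "\<forall>\<^sub>F n in sequentially. ?err n \<le> bound n"
  proof -
    \<comment> \<open>This says \<open>t \<le> g / 2\<close>: the null mass removed by mixing costs
      at most half of what the other component adds.\<close>
    have "\<forall>\<^sub>F n in sequentially. real n powr - s \<le> real n powr - \<kappa> / 2"
      using \<kappa>_less by real_asymp
    moreover have "\<forall>\<^sub>F n in sequentially. exp (1 - real n powr \<gamma> / 4) < 1 / (real n)\<^sup>2"
      using \<gamma> by real_asymp
    moreover have "\<forall>\<^sub>F n in sequentially. 2 \<le> n" by (rule eventually_ge_at_top)
    moreover have "\<forall>\<^sub>F n in sequentially. \<forall>i\<in>{1..n}. ennreal (real n powr - \<kappa>)
        \<le> (\<integral>\<^sup>+ u. ennreal (Q n i u) * indicator {2 * s * ln (real n)..} u \<partial>lborel)"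
      by (rule APLC_tail_ge[where r = r and \<sigma> = \<sigma> and s' = s'])
        (fact r \<sigma> Q_meas APLC s \<kappa>)+
    ultimately show ?thesis
    proof eventually_elim
      case (elim n)
      define N where "N = real n"
      have N: "2 \<le> N" "1 \<le> n" "0 < N" using elim(3) by (auto simp: N_def)
      \<comment> \<open>\<open>a\<close> is the null mean of the count, \<open>d\<close> a lower bound for its excess, and \<open>w = 1 / \<surd>a\<close>.\<close>
      define \<epsilon> where "\<epsilon> = N powr - \<beta>"
      define t where "t = N powr - s"
      define g where "g = N powr - \<kappa>"
      define a where "a = N powr (1 - s)"
      define d where "d = N powr (1 - \<beta> - \<kappa>) / 2"
      define w where "w = N powr ((s - 1) / 2)"
      have le1: "N powr x \<le> 1" if "x \<le> 0" for x
        using powr_mono[of x 0 N] that N by simp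
      have \<epsilon>: "0 \<le> \<epsilon>" "\<epsilon> \<le> 1" using N \<beta> by (auto simp: \<epsilon>_def intro: le1)
      have t: "0 < t" "t \<le> 1" using N s by (auto simp: t_def intro: le1)
      have w: "0 < w" "w \<le> 1" using N s by (auto simp: w_def intro: le1)
      have a: "0 < a" "N * t = a" using N by (auto simp: a_def t_def powr_diff powr_minus field_simps)
      have d: "0 < d" using N by (simp add: d_def)
      have wa: "w\<^sup>2 * a = 1" using N by (simp add: w_def a_def power2_eq_square flip: powr_add)
      have wd: "w * d = N powr \<gamma> / 2"
        using N by (simp add: w_def d_def \<gamma>_def field_simps flip: powr_add)
      have mean: "a + d \<le> N * ((1 - \<epsilon>) * t + \<epsilon> * g)"
      proof -
        have "d = N * \<epsilon> * (g / 2)"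
          using N by (simp add: d_def \<epsilon>_def g_def powr_diff powr_minus powr_add field_simps)
        also have "\<dots> \<le> N * \<epsilon> * (g - t)"
          using elim(1) N \<epsilon> by (intro mult_left_mono) (auto simp: g_def t_def N_def)
        finally show ?thesis using a(2) by (simp add: algebra_simps)
      qed
      \<comment> \<open>With Chernoff parameter \<open>w\<close>, the quadratic term
        \<open>a * w\<^sup>2\<close> is 1, while the linear gain \<open>w * d / 2\<close> is
        \<open>N powr \<gamma> / 4\<close>.\<close>
      have tail: "bin_tail n k t < 1 / N\<^sup>2" if k: "a + d / 2 \<le> real k" for k
      proof -
        have "bin_tail n k t \<le> exp (N * t * (exp w - 1) - w * real k)"
          unfolding N_def using t w by (intro bin_tail_chernoff) auto
        also have "\<dots> \<le> exp (1 - N powr \<gamma> / 4)"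
        proof -
          have "a * (exp w - 1) \<le> a * (w + w\<^sup>2)"
            using a w by (intro mult_left_mono exp_le_quadratic) auto
          moreover have "w * (a + d / 2) \<le> w * real k" using k w by (intro mult_left_mono) auto
          ultimately show ?thesis using wa wd unfolding a(2) by (simp add: algebra_simps)
        qed
        also have "\<dots> < 1 / N\<^sup>2" using elim(2) by (simp add: N_def)
        finally show ?thesis .
      qed
      have "measure (null_law n) {p \<in> space (null_law n). berk_jones n p < 1 / N\<^sup>2} \<le> 2 * real n * (1 / N\<^sup>2)"
        using N one_le_power[of N 2] by (intro berk_jones_null_bound) auto
      also have "\<dots> = 2 / N" using N by (simp add: N_def power2_eq_square)
      finally have null: "measure (null_law n) {p \<in> space (null_law n). berk_jones n p < 1 / N\<^sup>2} \<le> 2 / N" .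
      \<comment> \<open>The factor \<open>1 / 4\<close> gives
        \<open>v\<^sup>2 * d \<le> v * d / 4\<close>, so half of the linear gain
        \<open>v * d / 2\<close> survives: it is \<open>N powr \<gamma> / 32\<close>, against
        \<open>v\<^sup>2 * a = 1 / 16\<close>.\<close>
      define v where "v = w / 4"
      have v: "0 < v" "v \<le> 1 / 4" using w by (auto simp: v_def)
      have ln_t: "- 2 * ln t = 2 * s * ln (real n)" using N by (simp add: t_def ln_powr N_def)
      have "measure (alt_law \<epsilon> (Q n) n) {p \<in> space (alt_law \<epsilon> (Q n) n). 1 / N\<^sup>2 \<le> berk_jones n p}
          \<le> exp (v * (a + d / 2) - (1 - exp (- v)) * real n * ((1 - \<epsilon>) * t + \<epsilon> * g))"
      proof (rule berk_jones_alt_bound)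
        show "ennreal g \<le> (\<integral>\<^sup>+ u. ennreal (Q n i u) * indicator {- 2 * ln t..} u \<partial>lborel)"
          if "i \<in> {1..n}" for i
          using elim(4) that unfolding ln_t g_def N_def by blast
      qed (use N \<epsilon> t v a d tail Q_meas Q_nonneg Q_supp Q_prob in \<open>auto simp: g_def\<close>)
      also have "\<dots> \<le> exp (1 / 16 - N powr \<gamma> / 32)"
      proof -
        have "(v - v\<^sup>2) * (a + d) \<le> (1 - exp (- v)) * (N * ((1 - \<epsilon>) * t + \<epsilon> * g))"
          using v a d mean exp_le_quadratic(2)[of v] by (intro mult_mono) auto
        moreover have "v * v * d \<le> 1 / 4 * v * d" using v d by (intro mult_right_mono) auto
        moreover have "v\<^sup>2 * a = 1 / 16" using wa by (simp add: v_def power_divide)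
        moreover have "v * d = N powr \<gamma> / 8" using wd unfolding v_def by linarith
        ultimately show ?thesis by (simp add: algebra_simps power2_eq_square N_def)
      qed
      finally show ?case using null by (simp add: bound_def \<epsilon>_def N_def)
    qed
  qed
  moreover have "bound \<longlonglongrightarrow> 0" unfolding bound_def using \<gamma> by real_asymp
  ultimately have "?err \<longlonglongrightarrow> 0"
    by (intro tendsto_sandwich[of "\<lambda>_. 0" ?err sequentially bound]) (auto intro!: always_eventually)
  then show ?thesis by (rule exI[where x = "\<lambda>n. 1 / (real n)\<^sup>2"])
qed

end
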